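(* For every $m$ with $1\le m\le N$ (and every ordering $e_1,\dots,e_N$), the graph $G_m$ has a maximum matching $M$ that intersects every edge of $G^{\mathrm{all}}_m$, i.e. every edge of $G^{\mathrm{all}}_m$ has at least one endpoint covered by $M$.
   Context: Let $n$ be an even integer, $V$ a set of $n$ vertices, $N=\binom n2$. For a graph $G$, $\nu(G)$ is the size of a maximum matching and $\tau(G)$ the minimum cardinality of a vertex cover (a set of vertices incident to every edge). $G$ is a König graph (has property $\mathcal K$) if $\nu(G)=\tau(G)$. The König process: let $e_1,\dots,e_N$ be an ordering of the edges of the complete graph on $V$ (chosen uniformly at random). $G_0$ is the empty graph on $V$. For $0\le m<N$, $G_{m+1}=G_m+e_{m+1}$ if $G_m+e_{m+1}$ is König, and $G_{m+1}=G_m$ otherwise. $G^{\mathrm{all}}_m$ is the graph on $V$ with edge set $\{e_1,\dots,e_m\}$. *)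

theory Defs
  imports Complex_Main
begin

text \<open>
  A finite simple graph is given by its vertex set \<open>V\<close> and its edge set \<open>E\<close>, each edge being a
  two-element subset of \<open>V\<close>.
\<close>

definition complete_edges :: "'a set \<Rightarrow> 'a set set" where
  "complete_edges V = {e. e \<subseteq> V \<and> card e = 2}"

definition matching :: "'a set set \<Rightarrow> 'a set set \<Rightarrow> bool" where
  "matching E M \<longleftrightarrow> M \<subseteq> E \<and> pairwise disjnt M"

definition vertex_cover :: "'a set \<Rightarrow> 'a set set \<Rightarrow> 'a set \<Rightarrow> bool" where
  "vertex_cover V E C \<longleftrightarrow> C \<subseteq> V \<and> (\<forall>e\<in>E. e \<inter> C \<noteq> {})"

text \<open>
  For finite \<open>V\<close> and \<open>E \<subseteq> complete_edges V\<close> the \<open>Max\<close> and \<open>Min\<close> below range over finite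
  nonempty sets: \<open>{}\<close> is a matching and \<open>V\<close> is a vertex cover.
\<close>

definition matching_number :: "'a set set \<Rightarrow> nat" where
  "matching_number E = Max (card ` {M. matching E M})"

definition cover_number :: "'a set \<Rightarrow> 'a set set \<Rightarrow> nat" where
  "cover_number V E = Min (card ` {C. vertex_cover V E C})"

definition maximum_matching :: "'a set set \<Rightarrow> 'a set set \<Rightarrow> bool" where
  "maximum_matching E M \<longleftrightarrow> matching E M \<and> card M = matching_number E"

definition konig :: "'a set \<Rightarrow> 'a set set \<Rightarrow> bool" where
  "konig V E \<longleftrightarrow> matching_number E = cover_number V E"

text \<open>Edge sequences are indexed from 1, so the value \<open>e 0\<close> is never used.\<close>

primrec konig_process :: "'a set \<Rightarrow> (nat \<Rightarrow> 'a set) \<Rightarrow> nat \<Rightarrow> 'a set set" where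
  "konig_process V e 0 = {}"
| "konig_process V e (Suc m) =
    (if konig V (insert (e (Suc m)) (konig_process V e m))
     then insert (e (Suc m)) (konig_process V e m)
     else konig_process V e m)"

definition all_edges_upto :: "(nat \<Rightarrow> 'a set) \<Rightarrow> nat \<Rightarrow> 'a set set" where
  "all_edges_upto e m = e ` {1..m}"

end

theory Submission
  imports Defs
begin

text \<open>
  The vertices of a matching \<open>M\<close> are all covered by some maximum matching: take one sharing as many
  edges with \<open>M\<close> as possible. Hence the required matching survives whenever an edge \<open>f\<close> is accepted;
  if \<open>f\<close> misses \<open>M\<close>, start from \<open>insert f M\<close>. An edge missed by a maximum matching of a Koenig
  graph raises both the matching number and the cover number by one and is therefore accepted, so
  rejected edges are already met.
\<close>

section \<open>Edges and matchings\<close>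

lemma finite_complete_edges: "finite V \<Longrightarrow> finite (complete_edges V)"
  by (auto simp: complete_edges_def intro: finite_subset[of _ "Pow V"])

lemma complete_edges_inter_nonempty: "f \<in> complete_edges V \<Longrightarrow> f \<inter> V \<noteq> {}"
  by (auto simp: complete_edges_def Int_absorb2)

lemma matching_empty: "matching E {}"
  by (simp add: matching_def)

lemma matching_mono: "matching E M \<Longrightarrow> E \<subseteq> F \<Longrightarrow> matching F M"
  by (auto simp: matching_def)

lemma matching_edge_unique:
  "matching E M \<Longrightarrow> f \<in> M \<Longrightarrow> g \<in> M \<Longrightarrow> x \<in> f \<Longrightarrow> x \<in> g \<Longrightarrow> f = g"
  by (auto simp: matching_def pairwise_def disjnt_iff)

lemma matching_insert:
  assumes "matching E M" "f \<in> E" "f \<inter> \<Union>M = {}"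
  shows "matching E (insert f M)"
  using assms by (auto simp: matching_def pairwise_insert disjnt_def)

lemma finite_matching: "finite E \<Longrightarrow> matching E M \<Longrightarrow> finite M"
  by (auto simp: matching_def intro: finite_subset)

lemma finite_matchings: "finite E \<Longrightarrow> finite {M. matching E M}"
  by (rule finite_subset[of _ "Pow E"]) (auto simp: matching_def)

lemma card_matching_le: "finite E \<Longrightarrow> matching E M \<Longrightarrow> card M \<le> matching_number E"
  unfolding matching_number_def by (rule Max_ge) (auto simp: finite_matchings)

lemma ex_maximum_matching:
  assumes "finite E"
  shows "\<exists>M. maximum_matching E M"
proof -
  have "matching_number E \<in> card ` {M. matching E M}"
    unfolding matching_number_def
    by (rule Max_in) (use finite_matchings[OF assms] matching_empty in auto)
  then show ?thesis
    by (auto simp: maximum_matching_def)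
qed

section \<open>Vertex covers and weak duality\<close>

lemma cover_number_le:
  assumes "finite V" "vertex_cover V E C"
  shows "cover_number V E \<le> card C"
proof -
  have "finite {C. vertex_cover V E C}"
    by (rule finite_subset[of _ "Pow V"]) (use assms in \<open>auto simp: vertex_cover_def\<close>)
  then show ?thesis
    unfolding cover_number_def using assms by (intro Min_le) auto
qed

lemma ex_minimum_vertex_cover:
  assumes "finite V" "E \<subseteq> complete_edges V"
  shows "\<exists>C. vertex_cover V E C \<and> card C = cover_number V E"
proof -
  have "vertex_cover V E V"
    unfolding vertex_cover_def using assms(2) complete_edges_inter_nonempty by blast
  moreover have "finite {C. vertex_cover V E C}"
    by (rule finite_subset[of _ "Pow V"]) (use assms in \<open>auto simp: vertex_cover_def\<close>)
  ultimately have "cover_number V E \<in> card ` {C. vertex_cover V E C}"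
    unfolding cover_number_def by (intro Min_in) auto
  then show ?thesis
    by auto
qed

text \<open>Choosing in each matching edge one vertex of the cover is injective, because distinct
  matching edges are disjoint.\<close>

lemma card_matching_le_card_vertex_cover:
  assumes "finite V" "matching E M" "vertex_cover V E C"
  shows "card M \<le> card C"
proof -
  have "\<forall>f\<in>M. \<exists>x. x \<in> f \<inter> C"
    using assms unfolding matching_def vertex_cover_def by blast
  then obtain c where c: "\<And>f. f \<in> M \<Longrightarrow> c f \<in> f \<inter> C"
    by metis
  have "inj_on c M"
  proof (rule inj_onI)
    fix f g assume "f \<in> M" "g \<in> M" "c f = c g"
    then show "f = g"
      using c[of f] c[of g] matching_edge_unique[OF assms(2)] by auto
  qed
  moreover have "c ` M \<subseteq> C" "finite C"
    using c assms by (auto simp: vertex_cover_def intro: finite_subset)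
  ultimately show ?thesis
    by (rule card_inj_on_le)
qed

lemma matching_number_le_cover_number:
  assumes "finite V" "E \<subseteq> complete_edges V"
  shows "matching_number E \<le> cover_number V E"
proof -
  have "finite E"
    by (rule finite_subset[OF assms(2) finite_complete_edges[OF assms(1)]])
  then obtain M where "maximum_matching E M"
    using ex_maximum_matching by blast
  moreover obtain C where "vertex_cover V E C" "card C = cover_number V E"
    using ex_minimum_vertex_cover[OF assms] by blast
  ultimately show ?thesis
    using card_matching_le_card_vertex_cover[OF assms(1)] by (metis maximum_matching_def)
qed

text \<open>One endpoint of \<open>f\<close>, added to a minimum cover of \<open>E\<close>, covers
  \<open>insert f E\<close>.\<close>

lemma cover_number_insert_le:
  assumes "finite V" "insert f E \<subseteq> complete_edges V"
  shows "cover_number V (insert f E) \<le> Suc (cover_number V E)"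
proof -
  obtain C where C: "vertex_cover V E C" "card C = cover_number V E"
    using ex_minimum_vertex_cover[of V E] assms by auto
  obtain x where "x \<in> f" "x \<in> V"
    using assms(2) complete_edges_inter_nonempty by blast
  then have "vertex_cover V (insert f E) (insert x C)"
    using C(1) by (auto simp: vertex_cover_def)
  then have "cover_number V (insert f E) \<le> card (insert x C)"
    by (rule cover_number_le[OF assms(1)])
  also have "\<dots> \<le> Suc (card C)"
    by (rule card_insert_le_m1) auto
  finally show ?thesis
    using C(2) by simp
qed

section \<open>Exchange argument for maximum matchings\<close>

lemma ex_maximum_matching_covering:
  assumes "finite V" "E \<subseteq> complete_edges V" "matching E M"
  shows "\<exists>M'. maximum_matching E M' \<and> \<Union>M \<subseteq> \<Union>M'"
proof -
  have finE: "finite E"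
    by (rule finite_subset[OF assms(2) finite_complete_edges[OF assms(1)]])
  \<comment> \<open>A bound on the overlap with \<open>M\<close> that does not depend on
    \<open>M'\<close>, so that some maximum matching attains the largest overlap.\<close>
  have "card (M \<inter> M') < Suc (card M)" for M'
    using finite_matching[OF finE assms(3)] by (simp add: card_mono less_Suc_eq_le)
  then obtain M' where M': "maximum_matching E M'"
    and greatest: "\<And>K. maximum_matching E K \<Longrightarrow> card (M \<inter> K) \<le> card (M \<inter> M')"
    using ex_maximum_matching[OF finE]
      ex_has_greatest_nat[of "maximum_matching E" _ "\<lambda>K. card (M \<inter> K)"] by metis
  have mM': "matching E M'" and finM': "finite M'"
    using M' finite_matching[OF finE] by (auto simp: maximum_matching_def)
  have "v \<in> \<Union>M'" if "v \<in> \<Union>M" for v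
  proof (rule ccontr)
    assume v: "v \<notin> \<Union>M'"
    obtain f where f: "f \<in> M" "v \<in> f"
      using \<open>v \<in> \<Union>M\<close> by blast
    have fE: "f \<in> E"
      using f assms(3) by (auto simp: matching_def)
    then have "card f = 2"
      using assms(2) by (auto simp: complete_edges_def)
    then obtain w where w: "f = {v, w}"
      using f(2) by (auto simp: card_2_iff)
    have fM': "f \<notin> M'"
      using f v by blast
    \<comment> \<open>If \<open>M'\<close> missed both ends of \<open>f\<close>, adding
      \<open>f\<close> would give a larger matching.\<close>
    have "w \<in> \<Union>M'"
    proof (rule ccontr)
      assume "w \<notin> \<Union>M'"
      then have "matching E (insert f M')"
        using matching_insert[OF mM' fE] v w by auto
      then have "card (insert f M') \<le> matching_number E"
        by (rule card_matching_le[OF finE])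
      then show False
        using fM' finM' M' by (simp add: maximum_matching_def)
    qed
    then obtain g where g: "w \<in> g" "g \<in> M'"
      by blast
    \<comment> \<open>Exchanging \<open>g\<close> for \<open>f\<close> keeps a maximum matching:
      \<open>M'\<close> misses \<open>v\<close>, and \<open>g\<close> is its only edge at
      \<open>w\<close>.\<close>
    let ?K = "insert f (M' - {g})"
    have "matching E (M' - {g})"
      using mM' by (auto simp: matching_def pairwise_def)
    moreover have "f \<inter> \<Union>(M' - {g}) = {}"
      using v w g matching_edge_unique[OF mM'] by blast
    ultimately have "matching E ?K"
      using fE by (intro matching_insert)
    moreover have "card ?K = card M'"
      using fM' finM' card_Suc_Diff1[OF finM' g(2)] by simp
    ultimately have "card (M \<inter> ?K) \<le> card (M \<inter> M')"
      using greatest M' by (simp add: maximum_matching_def)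
    \<comment> \<open>\<open>M\<close> already has \<open>f\<close> at \<open>w\<close>, and
      \<open>f\<close> differs from \<open>g\<close> since only \<open>g\<close> lies in
      \<open>M'\<close>. So the exchange loses no common edge and gains \<open>f\<close>, against
      the choice of \<open>M'\<close>.\<close>
    moreover have "g \<notin> M"
      using f(1) g w fM' matching_edge_unique[OF assms(3), of f g w] by auto
    then have "M \<inter> ?K = insert f (M \<inter> M')"
      using f(1) by auto
    ultimately show False
      using fM' finM' by simp
  qed
  then show ?thesis
    using M' by blast
qed

section \<open>The Koenig property\<close>

lemma konig_empty:
  assumes "finite V"
  shows "konig V {}"
proof -
  have "cover_number V {} = 0"
    using cover_number_le[OF assms, of "{}" "{}"] by (simp add: vertex_cover_def)
  then show ?thesis
    using matching_number_le_cover_number[OF assms, of "{}"] by (simp add: konig_def)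
qed

text \<open>Read contrapositively, this says that a rejected edge meets every maximum matching of
  the current graph.\<close>

lemma konig_insert:
  assumes "finite V" "insert f E \<subseteq> complete_edges V" "konig V E"
    and "maximum_matching E M" "f \<inter> \<Union>M = {}"
  shows "konig V (insert f E)"
proof -
  have finE: "finite (insert f E)"
    by (rule finite_subset[OF assms(2) finite_complete_edges[OF assms(1)]])
  have mM: "matching (insert f E) M"
    using assms(4) matching_mono[of E M] by (auto simp: maximum_matching_def)
  \<comment> \<open>Disjointness from the union of \<open>M\<close> excludes \<open>f\<close> from
    \<open>M\<close> only because \<open>f\<close> is nonempty.\<close>
  have "f \<noteq> {}"
    using assms(2) by (auto simp: complete_edges_def)
  then have "f \<notin> M"
    using assms(5) by blast
  then have "Suc (matching_number E) = card (insert f M)"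
    using finite_matching[OF finE mM] assms(4) by (simp add: maximum_matching_def)
  also have "\<dots> \<le> matching_number (insert f E)"
    by (intro card_matching_le[OF finE] matching_insert[OF mM _ assms(5)]) simp
  \<comment> \<open>The chain closes: new cover number \<le> old cover number + 1 = old matching
    number + 1 \<le> new matching number \<le> new cover number.\<close>
  finally show ?thesis
    using cover_number_insert_le[OF assms(1,2)] assms(3)
      matching_number_le_cover_number[OF assms(1,2)]
    by (simp add: konig_def)
qed

section \<open>The process\<close>

lemma all_edges_upto_Suc: "all_edges_upto e (Suc m) = insert (e (Suc m)) (all_edges_upto e m)"
  by (simp add: all_edges_upto_def atLeastAtMostSuc_conv)

lemma konig_process_subset: "konig_process V e m \<subseteq> all_edges_upto e m"
  by (induction m) (auto simp: all_edges_upto_Suc)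

lemma konig_konig_process:
  assumes "finite V"
  shows "konig V (konig_process V e m)"
  by (induction m) (auto simp: konig_empty[OF assms])

text \<open>The hypothesis on \<open>e\<close> concerns only the first \<open>m\<close> edges, so it
  passes to shorter prefixes and supports the induction on \<open>m\<close>.\<close>

lemma konig_process_maximum_matching:
  assumes "finite V" "all_edges_upto e m \<subseteq> complete_edges V"
  shows "\<exists>M. maximum_matching (konig_process V e m) M \<and>
             (\<forall>f \<in> all_edges_upto e m. f \<inter> \<Union>M \<noteq> {})"
  using assms(2)
proof (induction m)
  case 0
  then show ?case
    using ex_maximum_matching[of "{}"] by (simp add: all_edges_upto_def)
next
  case (Suc m)
  define E f where "E = konig_process V e m" and "f = e (Suc m)"
  have all: "all_edges_upto e (Suc m) = insert f (all_edges_upto e m)"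
    by (simp add: all_edges_upto_Suc f_def)
  then obtain M where M: "maximum_matching E M" "\<forall>g \<in> all_edges_upto e m. g \<inter> \<Union>M \<noteq> {}"
    using Suc by (auto simp: E_def)
  have sub: "insert f E \<subseteq> complete_edges V"
    using Suc.prems konig_process_subset[of V e m] by (auto simp: all E_def)
  show ?case
  proof (cases "konig V (insert f E)")
    case True
    have mM: "matching (insert f E) M"
      using M(1) matching_mono[of E M] by (auto simp: maximum_matching_def)
    \<comment> \<open>\<open>M1\<close> meets \<open>f\<close> and all earlier edges, but need not
      be maximum in \<open>insert f E\<close>: when \<open>f\<close> meets \<open>M\<close>, the new
      edge may still complete an augmenting path. Passing to an \<open>M'\<close> that covers its
      vertices repairs this.\<close>
    define M1 where "M1 = (if f \<inter> \<Union>M = {} then insert f M else M)"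
    have "matching (insert f E) M1"
      using mM by (simp add: M1_def matching_insert)
    then obtain M' where M': "maximum_matching (insert f E) M'" "\<Union>M1 \<subseteq> \<Union>M'"
      using ex_maximum_matching_covering[OF assms(1) sub] by blast
    have "f \<noteq> {}"
      using sub by (auto simp: complete_edges_def)
    then have "\<forall>g \<in> insert f (all_edges_upto e m). g \<inter> \<Union>M1 \<noteq> {}"
      using M(2) by (auto simp: M1_def)
    then have "\<forall>g \<in> all_edges_upto e (Suc m). g \<inter> \<Union>M' \<noteq> {}"
      unfolding all using Int_mono[OF order_refl M'(2)] by (metis subset_empty)
    moreover have "konig_process V e (Suc m) = insert f E"
      using True by (simp add: E_def f_def)
    ultimately show ?thesis
      using M'(1) by auto
  next
    case False
    \<comment> \<open>Were \<open>f\<close> disjoint from all edges of \<open>M\<close>, it would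
      have been accepted; hence the old \<open>M\<close> still serves.\<close>
    then have "f \<inter> \<Union>M \<noteq> {}"
      using konig_insert[OF assms(1) sub _ M(1)] konig_konig_process[OF assms(1)]
      by (auto simp: E_def)
    then have "\<forall>g \<in> all_edges_upto e (Suc m). g \<inter> \<Union>M \<noteq> {}"
      using M(2) by (simp add: all)
    moreover have "konig_process V e (Suc m) = E"
      using False by (simp add: E_def f_def)
    ultimately show ?thesis
      using M(1) by auto
  qed
qed

theorem proposition1p1:
  fixes V :: "'a set" and n N m :: nat and e :: "nat \<Rightarrow> 'a set"
  assumes "finite V" and "card V = n" and "even n"
    and "N = n choose 2"
    and "bij_betw e {1..N} (complete_edges V)"
    and "1 \<le> m" and "m \<le> N"
  shows "\<exists>M. maximum_matching (konig_process V e m) M \<and>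
             (\<forall>f \<in> all_edges_upto e m. f \<inter> \<Union>M \<noteq> {})"
proof (rule konig_process_maximum_matching[OF assms(1)])
  have "{1..m} \<subseteq> {1..N}"
    using assms(7) by auto
  then show "all_edges_upto e m \<subseteq> complete_edges V"
    using assms(5) unfolding all_edges_upto_def bij_betw_def by blast
qed

end
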